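(* For integers $1\le m\le i<n$ and every $a\in\mathbb Z$, $$D_{{\bf p}_m(a)}({\bf h}_i)={\bf h}_{i-m}.$$
   Context: Fix $n\ge2$. $\widetilde S_n$ is the affine symmetric group (bijections $w$ of $\mathbb Z$ with $w(i+n)=w(i)+n$, $\sum_{i=1}^nw(i)=\sum_{i=1}^ni$), Coxeter generators $s_0,\dots,s_{n-1}$ (indices mod $n$), length $\ell$; for $i<j$, $i\not\equiv j\pmod n$, $t_{ij}$ swaps $i+rn$ and $j+rn$ for all $r$. $\mathbb A$ is the affine nilCoxeter algebra over $\mathbb Q$ with basis $A_w$. A word $s_{i_1}\cdots s_{i_l}$ is cyclically decreasing if each index occurs at most once and whenever $s_i$ and $s_{i+1}$ both occur, $s_{i+1}$ precedes $s_i$; for $J\subsetneq\mathbb Z/n\mathbb Z$, $w_J$ is the element of any cyclically decreasing word using exactly $\{s_j:j\in J\}$. ${\bf h}_i=\sum_{|J|=i}A_{w_J}$ for $0\le i<n$, with ${\bf h}_0=1$. Symbols $[ij]$ ($i<j$, $i\not\equiv j$) act on the right on $\mathbb A$ by $A_w\cdot[ij]=A_{wt_{ij}}$ if $\ell(wt_{ij})=\ell(w)-1$, else $0$, extended multiplicatively and linearly to formal sums; $D_{\bf x}(A_w):=A_w\cdot{\bf x}$. MN element ${\bf p}_m(a)$: a connected tree on $\mathcal D_a$ is a finite set $D$ of boxes $(i,j)$ with $i\le a<j$ such that the graph on $\mathbb Z$ with an edge $\{i,j\}$ per box has its non-isolated vertices forming a single tree with pairwise distinct residues mod $n$; $c(D)$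 is the number of tree vertices $\le a$. For a bijection $L:\{1,\dots,|D|\}\to D$, $L(t)=(i_t,j_t)$, put $x_{D_L}=[i_1j_1]\cdots[i_{|D|}j_{|D|}]$; labelings are equivalent if their words differ by swaps of adjacent letters with disjoint supports. With $l$ the number of distinct second coordinates in $D$ and $v=|D|-l$, $M(D)$ is a set of one representative from each equivalence class containing a labeling with $i_1,\dots,i_{l-1}$ distinct, $j_1\le\dots\le j_{l-1}$, $j_l,\dots,j_{l+v}$ distinct, $i_l\le\dots\le i_{l+v}$. ${\bf p}_m(a)=\sum_D\sum_{L\in M(D)}(-1)^{c(D)-1}x_{D_L}$ over connected trees on $\mathcal D_a$ with $m$ boxes.
   Formalization: In the definition of M(D), l is taken as the number of distinct first coordinates in D (tree vertices ≤ a), not second coordinates; with second coordinates the identity fails, e.g. for n=4, i=m=3, a=0, where the left side is 0. *)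

theory Defs
  imports Complex_Main "HOL-Library.Poly_Mapping"
begin

subsection \<open>The affine symmetric group\<close>

definition affine_sym :: "nat \<Rightarrow> (int \<Rightarrow> int) set" where
  "affine_sym n = {w. bij w \<and> (\<forall>i. w (i + int n) = w i + int n) \<and>
     (\<Sum>i = 1..int n. w i) = (\<Sum>i = 1..int n. i)}"

definition transp :: "nat \<Rightarrow> int \<Rightarrow> int \<Rightarrow> int \<Rightarrow> int" where
  "transp n i j k =
     (if k mod int n = i mod int n then k + (j - i)
      else if k mod int n = j mod int n then k - (j - i)
      else k)"

definition sgen :: "nat \<Rightarrow> int \<Rightarrow> int \<Rightarrow> int" where
  "sgen n i = transp n i (i + 1)"

definition word_prod :: "nat \<Rightarrow> int list \<Rightarrow> int \<Rightarrow> int" where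
  "word_prod n is = foldr (\<circ>) (map (sgen n) is) id"

text \<open>Residues modulo \<open>n\<close> are represented by \<open>0, \<dots>, n - 1\<close>.\<close>

definition len :: "nat \<Rightarrow> (int \<Rightarrow> int) \<Rightarrow> nat" where
  "len n w = (LEAST k. \<exists>is. set is \<subseteq> {0..<int n} \<and> length is = k \<and> word_prod n is = w)"

definition cyc_decreasing :: "nat \<Rightarrow> int list \<Rightarrow> bool" where
  "cyc_decreasing n is \<longleftrightarrow> set is \<subseteq> {0..<int n} \<and> distinct is \<and>
     (\<forall>p < length is. \<forall>q < length is. is ! q = (is ! p + 1) mod int n \<longrightarrow> q < p)"

definition cyc_elt :: "nat \<Rightarrow> int set \<Rightarrow> int \<Rightarrow> int" where
  "cyc_elt n J = (THE w. w \<in> affine_sym n \<and>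
     (\<exists>is. cyc_decreasing n is \<and> set is = J \<and> word_prod n is = w))"


subsection \<open>The affine nilCoxeter algebra and the right action of the symbols \<open>[ij]\<close>\<close>

text \<open>
  Only the \<open>\<rat>\<close>-vector space structure of the algebra is involved, together with its unit
  \<open>nc_basis id\<close>. Its elements are the finitely supported functions with support in
  \<open>affine_sym n\<close>.
\<close>

type_synonym nilcox = "(int \<Rightarrow> int) \<Rightarrow>\<^sub>0 rat"

definition nc_basis :: "(int \<Rightarrow> int) \<Rightarrow> nilcox" where
  "nc_basis w = Poly_Mapping.single w 1"

definition nc_scale :: "rat \<Rightarrow> nilcox \<Rightarrow> nilcox" where
  "nc_scale c f = Poly_Mapping.map ((*) c) f"

definition nc_h :: "nat \<Rightarrow> nat \<Rightarrow> nilcox" where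
  "nc_h n i = (\<Sum>J | J \<subset> {0..<int n} \<and> card J = i. nc_basis (cyc_elt n J))"

definition act_basis :: "nat \<Rightarrow> (int \<Rightarrow> int) \<Rightarrow> int \<times> int \<Rightarrow> nilcox" where
  "act_basis n w = (\<lambda>(i, j).
     if len n (w \<circ> transp n i j) + 1 = len n w then nc_basis (w \<circ> transp n i j) else 0)"

definition act_letter :: "nat \<Rightarrow> nilcox \<Rightarrow> int \<times> int \<Rightarrow> nilcox" where
  "act_letter n f b =
     (\<Sum>w \<in> Poly_Mapping.keys f. nc_scale (Poly_Mapping.lookup f w) (act_basis n w b))"

definition act_word :: "nat \<Rightarrow> nilcox \<Rightarrow> (int \<times> int) list \<Rightarrow> nilcox" where
  "act_word n f u = foldl (act_letter n) f u"

text \<open>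
  A possibly infinite formal sum of words in the symbols is given by its coefficients. The sums
  of interest are locally finite: only finitely many of their words act nontrivially on a given
  element, so that \<open>Sum_any\<close> is a genuine finite sum.
\<close>

type_synonym formal_sum = "(int \<times> int) list \<Rightarrow> rat"

definition D_op :: "nat \<Rightarrow> formal_sum \<Rightarrow> nilcox \<Rightarrow> nilcox" where
  "D_op n x f = Sum_any (\<lambda>u. nc_scale (x u) (act_word n f u))"


subsection \<open>Murnaghan-Nakayama elements\<close>

definition verts :: "(int \<times> int) set \<Rightarrow> int set" where
  "verts D = fst ` D \<union> snd ` D"

definition adj :: "(int \<times> int) set \<Rightarrow> (int \<times> int) set" where
  "adj D = D \<union> D\<inverse>"

definition graph_connected :: "(int \<times> int) set \<Rightarrow> bool" where
  "graph_connected D \<longleftrightarrow> (\<forall>x \<in> verts D. \<forall>y \<in> verts D. (x, y) \<in> (adj D)\<^sup>*)"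

definition graph_cycle :: "(int \<times> int) set \<Rightarrow> int list \<Rightarrow> bool" where
  "graph_cycle D vs \<longleftrightarrow> length vs \<ge> 3 \<and> distinct vs \<and>
     (\<forall>k. Suc k < length vs \<longrightarrow> (vs ! k, vs ! Suc k) \<in> adj D) \<and> (last vs, hd vs) \<in> adj D"

definition connected_tree :: "nat \<Rightarrow> int \<Rightarrow> (int \<times> int) set \<Rightarrow> bool" where
  "connected_tree n a D \<longleftrightarrow> finite D \<and> D \<noteq> {} \<and>
     (\<forall>(i, j) \<in> D. i \<le> a \<and> a < j) \<and>
     graph_connected D \<and> (\<nexists>vs. graph_cycle D vs) \<and>
     inj_on (\<lambda>x. x mod int n) (verts D)"

definition num_low :: "int \<Rightarrow> (int \<times> int) set \<Rightarrow> nat" where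
  "num_low a D = card {x \<in> verts D. x \<le> a}"

text \<open>
  A labeling \<open>L : {1, \<dots>, |D|} \<rightarrow> D\<close> is represented by the list \<open>[L 1, \<dots>, L |D|]\<close>, which is
  at the same time the word \<open>x\<^sub>D\<^sub>_\<^sub>L\<close>.
\<close>

definition labelings :: "(int \<times> int) set \<Rightarrow> (int \<times> int) list set" where
  "labelings D = {u. distinct u \<and> set u = D}"

definition swap_rel :: "((int \<times> int) list \<times> (int \<times> int) list) set" where
  "swap_rel = {(xs @ [p, q] @ ys, xs @ [q, p] @ ys) | xs p q ys.
     {fst p, snd p} \<inter> {fst q, snd q} = {}}"

text \<open>
  The first \<open>l - 1\<close> letters have distinct first and weakly increasing second coordinates, the
  remaining \<open>|D| - l + 1\<close> letters have distinct second and weakly increasing first coordinates.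
  Here \<open>l\<close> is the number of distinct \<^emph>\<open>first\<close> coordinates in \<open>D\<close>, i.e. the number of tree
  vertices \<open>\<le> a\<close>. Counting second coordinates instead would exclude every star
  \<open>{(i, j\<^sub>1), \<dots>, (i, j\<^sub>m)}\<close> with \<open>m \<ge> 3\<close>, since its first two letters share the first
  coordinate; the identity \<open>D_op (mn_p 3) (nc_h 3) = nc_h 0\<close> would then fail for \<open>n = 4\<close>.
\<close>

definition mn_ordered :: "(int \<times> int) list \<Rightarrow> bool" where
  "mn_ordered u \<longleftrightarrow> (let l = card (fst ` set u) in
     distinct (map fst (take (l - 1) u)) \<and> sorted (map snd (take (l - 1) u)) \<and>
     distinct (map snd (drop (l - 1) u)) \<and> sorted (map fst (drop (l - 1) u)))"

definition mn_classes :: "(int \<times> int) set \<Rightarrow> (int \<times> int) list set set" where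
  "mn_classes D = {C \<in> labelings D // swap_rel\<^sup>*. \<exists>u \<in> C. mn_ordered u}"

definition mn_reps :: "(int \<times> int) set \<Rightarrow> (int \<times> int) list set \<Rightarrow> bool" where
  "mn_reps D R \<longleftrightarrow> R \<subseteq> \<Union> (mn_classes D) \<and> (\<forall>C \<in> mn_classes D. \<exists>!u. u \<in> R \<and> u \<in> C)"

text \<open>
  The double sum over \<open>D\<close> and \<open>L \<in> M D\<close>, as a coefficient function: a word \<open>u\<close> arises from
  at most one pair, namely \<open>D = set u\<close> and \<open>L = u\<close>.
\<close>

definition mn_p :: "nat \<Rightarrow> ((int \<times> int) set \<Rightarrow> (int \<times> int) list set) \<Rightarrow> nat \<Rightarrow> int \<Rightarrow> formal_sum"
  where
  "mn_p n M m a u =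
     (if connected_tree n a (set u) \<and> card (set u) = m \<and> u \<in> M (set u)
      then (- 1) ^ (num_low a (set u) - 1) else 0)"

end

theory Submission
  imports Defs
begin

text \<open>
  The residues outside \<open>J\<close> cut \<open>\<int>\<close> into blocks, and \<open>w\<^sub>J\<close> sends the first element of a block
  to its last one and lowers the others by one. The length of any \<open>w\<close> is at least
  \<open>\<Sum>x = 1..n. max 0 (w x - x)\<close>, with equality for \<open>w\<^sub>J\<close>; comparing these sums shows that
  \<open>[ij]\<close> acts on \<open>w\<^sub>J\<close> nontrivially only if \<open>i\<close> starts the block containing \<open>j\<close>, and then it
  cuts this block before \<open>j\<close>. If moreover \<open>i \<le> a < j\<close>, then \<open>i\<close> is the start \<open>s\<close> of the block
  of \<open>a\<close>, and this remains so after the cut. Hence only words \<open>[s j\<^sub>1] \<dots> [s j\<^sub>m]\<close> with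
  \<open>j\<^sub>1 > \<dots> > j\<^sub>m\<close> survive. They label stars, whose sign is \<open>1\<close> and whose labelings are
  pairwise inequivalent. The set \<open>J\<close> and the word are determined by the resulting \<open>J'\<close>, because
  the \<open>j\<^sub>t - 1\<close> are the \<open>m\<close> smallest numbers \<open>\<ge> a\<close> with residue outside \<open>J'\<close>.
\<close>

section \<open>Periodic maps\<close>

definition periodic :: "nat \<Rightarrow> (int \<Rightarrow> int) \<Rightarrow> bool" where
  "periodic n w \<longleftrightarrow> (\<forall>x. w (x + int n) = w x + int n)"

lemma periodic_shift:
  assumes "periodic n w"
  shows "w (x + int n * k) = w x + int n * k"
proof (induction k rule: int_induct [of _ 0])
  case base
  show ?case by simp
next
  case (step1 k)
  have "w (x + int n * (k + 1)) = w ((x + int n * k) + int n)"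
    by (simp add: algebra_simps)
  also have "\<dots> = w (x + int n * k) + int n"
    using assms by (simp only: periodic_def)
  finally show ?case using step1 by (simp add: algebra_simps)
next
  case (step2 k)
  have "w (x + int n * k) = w ((x + int n * (k - 1)) + int n)"
    by (simp add: algebra_simps)
  also have "\<dots> = w (x + int n * (k - 1)) + int n"
    using assms by (simp only: periodic_def)
  finally show ?case using step2 by (simp add: algebra_simps)
qed

lemma mod_eq_shift:
  fixes x y :: int
  assumes "x mod n = y mod n"
  obtains k where "x = y + n * k"
proof -
  have "n dvd x - y" using assms by (simp add: mod_eq_dvd_iff)
  then obtain k where "x - y = n * k" ..
  then show ?thesis by (intro that [of k]) simp
qed

text \<open>The displacement \<open>w x - x\<close> is a function of the residue, so identities need
  checking at one representative only.\<close>

lemma periodic_mod_cong: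
  assumes "periodic n w" "x mod int n = y mod int n"
  shows "w x - x = w y - y"
  using assms(2) by (rule mod_eq_shift) (simp add: periodic_shift [OF assms(1)])

lemma periodic_comp: "periodic n v \<Longrightarrow> periodic n w \<Longrightarrow> periodic n (v \<circ> w)"
  by (simp add: periodic_def)

section \<open>The reflections t_ij\<close>

lemma periodic_transp: "periodic n (transp n i j)"
  by (simp add: periodic_def transp_def)

lemma transp_left [simp]: "transp n i j i = j"
  by (simp add: transp_def)

lemma transp_right [simp]: "i mod int n \<noteq> j mod int n \<Longrightarrow> transp n i j j = i"
  by (simp add: transp_def)

lemma transp_transp:
  assumes "i mod int n \<noteq> j mod int n"
  shows "transp n i j (transp n i j x) = x"
proof -
  have *: "(x + (j - i)) mod int n = j mod int n" if "x mod int n = i mod int n"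
    using that by (rule mod_eq_shift) simp
  have **: "(x - (j - i)) mod int n = i mod int n" if "x mod int n = j mod int n"
    using that by (rule mod_eq_shift) simp
  show ?thesis using assms * ** by (auto simp: transp_def)
qed

text \<open>Serves to reduce the index of a generator to \<open>{0..<int n}\<close>, the range that
  \<open>len\<close> demands of words.\<close>

lemma transp_shift:
  assumes "i mod int n = i' mod int n" "j - i = j' - i'"
  shows "transp n i j = transp n i' j'"
proof -
  have "j = j' + (i - i')" using assms(2) by simp
  then have "j mod int n = j' mod int n"
    using assms(1) by (metis add_0_right mod_add_right_eq mod_diff_cong diff_self mod_0)
  then show ?thesis using assms by (auto simp: transp_def fun_eq_iff)
qed

lemma periodic_inj_mod:
  assumes "periodic n s" "inj s" "s x mod int n = s y mod int n"
  shows "x mod int n = y mod int n"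
proof -
  obtain k where "s x = s y + int n * k" using assms(3) by (rule mod_eq_shift)
  then have "s x = s (y + int n * k)" by (simp add: periodic_shift [OF assms(1)])
  then have "x = y + int n * k" using assms(2) by (simp add: inj_eq)
  then show ?thesis by simp
qed

text \<open>The usual rule for conjugating a reflection, written so that no inverse of
  \<open>s\<close> appears. Periodicity and injectivity make \<open>s\<close> preserve and reflect
  congruence modulo \<open>n\<close>.\<close>

lemma transp_conj:
  assumes "periodic n s" "inj s"
  shows "transp n (s i) (s j) (s x) = s (transp n i j x)"
proof -
  have iff: "s x mod int n = s y mod int n \<longleftrightarrow> x mod int n = y mod int n" for y
  proof
    assume "x mod int n = y mod int n"
    then show "s x mod int n = s y mod int n"
      by (rule mod_eq_shift) (simp add: periodic_shift [OF assms(1)])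
  qed (rule periodic_inj_mod [OF assms])
  have "s (x + (j - i)) = s x + (s j - s i)" if x: "x mod int n = i mod int n"
  proof -
    obtain k where "x = i + int n * k" using x by (rule mod_eq_shift)
    moreover from this have "x + (j - i) = j + int n * k" by simp
    ultimately show ?thesis by (simp only: periodic_shift [OF assms(1)])
  qed
  moreover have "s (x - (j - i)) = s x - (s j - s i)" if x: "x mod int n = j mod int n"
  proof -
    obtain k where "x = j + int n * k" using x by (rule mod_eq_shift)
    moreover from this have "x - (j - i) = i + int n * k" by simp
    ultimately show ?thesis by (simp only: periodic_shift [OF assms(1)])
  qed
  ultimately show ?thesis by (auto simp: transp_def iff)
qed

text \<open>Right multiplication by t_ij changes displacements only in the residue classes of
  \<open>i\<close> and \<open>j\<close>, each of which meets the window once. With \<phi> the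
  identity this controls the sum in \<open>affine_sym\<close>, with \<open>max 0\<close> the lower
  bound for the length.\<close>

lemma sum_transp:
  fixes \<phi> :: "int \<Rightarrow> int"
  assumes n: "0 < n" and w: "periodic n w" and ij: "i mod int n \<noteq> j mod int n"
  shows "(\<Sum>x = 1..int n. \<phi> (w (transp n i j x) - x)) =
    (\<Sum>x = 1..int n. \<phi> (w x - x)) + \<phi> (w j - i) + \<phi> (w i - j) - \<phi> (w i - i) - \<phi> (w j - j)"
proof -
  \<comment> \<open>The representative of \<open>x\<close> in the window 1..n; the shift by one is
    there because \<open>mod\<close> takes values in 0..n-1.\<close>
  define r where "r x = (x - 1) mod int n + 1" for x
  have r_in: "r x \<in> {1..int n}" for x
  proof -
    have "0 \<le> (x - 1) mod int n" "(x - 1) mod int n < int n"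
      using n by (simp_all add: pos_mod_bound)
    then show ?thesis by (simp add: r_def)
  qed
  have r_mod: "r x mod int n = x mod int n" for x
    unfolding r_def by (metis diff_add_cancel mod_add_left_eq)
  have uniq: "x = r y" if "x \<in> {1..int n}" "x mod int n = y mod int n" for x y
  proof -
    have "r x = r y" unfolding r_def using that(2) by (metis mod_diff_left_eq)
    moreover have "r x = x" using that(1) by (simp add: r_def)
    ultimately show ?thesis by simp
  qed
  have ne: "r i \<noteq> r j" using r_mod ij by metis
  let ?v = "w \<circ> transp n i j"
  have v: "periodic n ?v" by (rule periodic_comp [OF w periodic_transp])
  have split: "(\<Sum>x = 1..int n. g x) = g (r i) + g (r j) + (\<Sum>x \<in> {1..int n} - {r i, r j}. g x)"
    for g :: "int \<Rightarrow> int"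
    using r_in [of i] r_in [of j] ne
    by (simp add: sum.remove [of _ "r i"] sum.remove [of _ "r j"] Diff_insert2 [symmetric] insert_commute)
  have rest: "(\<Sum>x \<in> {1..int n} - {r i, r j}. \<phi> (?v x - x)) = (\<Sum>x \<in> {1..int n} - {r i, r j}. \<phi> (w x - x))"
    using uniq by (intro sum.cong refl) (auto simp: transp_def)
  have "?v (r i) - r i = w j - i" "?v (r j) - r j = w i - j"
    using periodic_mod_cong [OF v r_mod] ij by simp_all
  moreover have "w (r i) - r i = w i - i" "w (r j) - r j = w j - j"
    using periodic_mod_cong [OF w r_mod] by simp_all
  ultimately show ?thesis
    using split [of "\<lambda>x. \<phi> (?v x - x)"] split [of "\<lambda>x. \<phi> (w x - x)"] rest by simp
qed

section \<open>Words in the generators and a lower bound for the length\<close>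

definition excedance :: "nat \<Rightarrow> (int \<Rightarrow> int) \<Rightarrow> int" where
  "excedance n w = (\<Sum>x = 1..int n. max 0 (w x - x))"

lemma excedance_transp:
  assumes "0 < n" "periodic n w" "i mod int n \<noteq> j mod int n"
  shows "excedance n (w \<circ> transp n i j) = excedance n w
    + max 0 (w j - i) + max 0 (w i - j) - max 0 (w i - i) - max 0 (w j - j)"
  using sum_transp [OF assms, of "max 0"] by (simp add: excedance_def)

lemma word_prod_Nil [simp]: "word_prod n [] = id"
  by (simp add: word_prod_def)

lemma word_prod_Cons [simp]: "word_prod n (x # xs) = sgen n x \<circ> word_prod n xs"
  by (simp add: word_prod_def)

lemma word_prod_append: "word_prod n (xs @ ys) = word_prod n xs \<circ> word_prod n ys"
  by (induction xs) (simp_all add: o_assoc)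

lemma periodic_word_prod: "periodic n (word_prod n xs)"
proof (induction xs)
  case Nil
  show ?case by (simp add: periodic_def)
next
  case (Cons x xs)
  then show ?case unfolding word_prod_Cons sgen_def by (intro periodic_comp periodic_transp)
qed

lemma mod_Suc_neq:
  assumes "2 \<le> n"
  shows "i mod int n \<noteq> (i + 1) mod int n" "(i + 1) mod int n \<noteq> i mod int n"
proof -
  have "\<not> int n dvd 1" using assms by auto
  then show "(i + 1) mod int n \<noteq> i mod int n"
    by (simp add: mod_eq_dvd_iff)
  then show "i mod int n \<noteq> (i + 1) mod int n" by simp
qed

lemma sgen_sgen: "2 \<le> n \<Longrightarrow> sgen n i (sgen n i x) = x"
  by (simp add: sgen_def transp_transp mod_Suc_neq)

lemma bij_word_prod: "2 \<le> n \<Longrightarrow> bij (word_prod n xs)"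
proof (induction xs)
  case (Cons x xs)
  have "bij (sgen n x)"
    by (rule o_bij [of "sgen n x"]) (simp_all add: fun_eq_iff sgen_sgen Cons.prems)
  then show ?case using Cons by (simp add: bij_comp del: o_apply)
qed simp

lemma word_prod_in_affine_sym:
  assumes "2 \<le> n"
  shows "word_prod n xs \<in> affine_sym n"
proof -
  have "(\<Sum>x = 1..int n. word_prod n xs x - x) = 0"
  proof (induction xs rule: rev_induct)
    case (snoc y xs)
    then show ?case
      using sum_transp [OF _ periodic_word_prod, of n y "y + 1" "\<lambda>x. x" xs] assms
      by (simp add: word_prod_append sgen_def mod_Suc_neq)
  qed simp
  then show ?thesis
    using periodic_word_prod [of n xs] bij_word_prod [OF assms]
    by (simp add: affine_sym_def periodic_def sum_subtractf)
qed

text \<open>Appending s_y costs at most one: the term carrying \<open>w (y + 1)\<close> grows by at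
  most one, because its reference point drops from \<open>y + 1\<close> to \<open>y\<close>, and the
  term carrying \<open>w y\<close> does not grow.\<close>

lemma excedance_word_prod:
  assumes "2 \<le> n"
  shows "excedance n (word_prod n xs) \<le> int (length xs)"
proof (induction xs rule: rev_induct)
  case Nil
  show ?case by (simp add: excedance_def)
next
  case (snoc y xs)
  have "word_prod n (xs @ [y]) = word_prod n xs \<circ> transp n y (y + 1)"
    by (simp add: word_prod_append sgen_def)
  then show ?case
    using snoc excedance_transp [OF _ periodic_word_prod, of n y "y + 1" xs] assms
    by (simp add: mod_Suc_neq del: o_apply)
qed

text \<open>\<open>len\<close> is a \<open>LEAST\<close> over words, hence informative only when
  some word exists; this predicate records that.\<close>

definition generated :: "nat \<Rightarrow> (int \<Rightarrow> int) \<Rightarrow> bool" where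
  "generated n w \<longleftrightarrow> (\<exists>xs. set xs \<subseteq> {0..<int n} \<and> word_prod n xs = w)"

lemma generated_comp: "generated n v \<Longrightarrow> generated n w \<Longrightarrow> generated n (v \<circ> w)"
  unfolding generated_def by (metis Un_least set_append word_prod_append)

lemma generated_sgen:
  assumes "0 < n"
  shows "generated n (sgen n i)"
proof -
  have "sgen n i = sgen n (i mod int n)"
    unfolding sgen_def by (rule transp_shift) simp_all
  then have "word_prod n [i mod int n] = sgen n i" by simp
  moreover have "set [i mod int n] \<subseteq> {0..<int n}" using assms by simp
  ultimately show ?thesis unfolding generated_def by blast
qed

text \<open>Conjugation by s_i turns t_ij into a reflection with lower index \<open>i + 1\<close>
  and upper index \<open>j\<close> or \<open>j - 1\<close>; the difference of the indices shrinks
  until the reflection is a generator.\<close>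

lemma generated_transp:
  assumes "2 \<le> n"
  shows "i < j \<Longrightarrow> i mod int n \<noteq> j mod int n \<Longrightarrow> generated n (transp n i j)"
proof (induction "nat (j - i)" arbitrary: i j rule: less_induct)
  case less
  show ?case
  proof (cases "j = i + 1")
    case True
    then show ?thesis using generated_sgen [of n i] assms by (simp add: sgen_def)
  next
    case False
    let ?s = "sgen n i"
    have s: "periodic n ?s" by (simp add: sgen_def periodic_transp)
    have inj: "inj ?s" by (rule injI) (metis assms sgen_sgen)
    have si: "?s i = i + 1" by (simp add: sgen_def)
    have sj: "?s j = (if j mod int n = (i + 1) mod int n then j - 1 else j)"
      using less.prems(2) by (simp add: sgen_def transp_def)
    have "i + 1 < ?s j"
    proof (cases "j mod int n = (i + 1) mod int n")
      case True
      \<comment> \<open>Here \<open>j\<close> exceeds \<open>i + 1\<close> by a positive multiple of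
        \<open>n\<close>, and \<open>n\<close> is at least 2, so \<open>j - 1\<close> is still
        larger than \<open>i + 1\<close>.\<close>
      then obtain k where k: "j = i + 1 + int n * k" by (rule mod_eq_shift)
      have "0 < int n * k" using k False less.prems(1) by linarith
      then have "0 < k" by (simp add: zero_less_mult_iff)
      then have "int n * 1 \<le> int n * k" by (intro mult_left_mono) simp_all
      then show ?thesis using k True sj assms by presburger
    next
      case no: False
      then show ?thesis using sj False less.prems(1) by simp
    qed
    moreover have "(i + 1) mod int n \<noteq> ?s j mod int n"
      using periodic_inj_mod [OF s inj, of i j] less.prems(2) si by auto
    moreover have "nat (?s j - (i + 1)) < nat (j - i)"
      using sj less.prems(1) by (auto split: if_splits)
    ultimately have "generated n (transp n (i + 1) (?s j))"
      using less.hyps by blast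
    moreover have "transp n i j = ?s \<circ> (transp n (i + 1) (?s j) \<circ> ?s)"
      using transp_conj [OF s inj, of i j] si assms by (simp add: fun_eq_iff sgen_sgen)
    moreover have "generated n ?s" using generated_sgen assms by simp
    ultimately show ?thesis by (simp add: generated_comp del: o_apply)
  qed
qed

lemma len_le: "set xs \<subseteq> {0..<int n} \<Longrightarrow> len n (word_prod n xs) \<le> length xs"
  unfolding len_def by (rule Least_le) blast

lemma excedance_le_len:
  assumes "2 \<le> n" "generated n w"
  shows "excedance n w \<le> int (len n w)"
proof -
  have "\<exists>k xs. set xs \<subseteq> {0..<int n} \<and> length xs = k \<and> word_prod n xs = w"
    using assms(2) by (auto simp: generated_def)
  from LeastI_ex [OF this] obtain xs where "length xs = len n w" "word_prod n xs = w"
    by (auto simp: len_def)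
  then show ?thesis using excedance_word_prod [OF assms(1), of xs] by simp
qed

section \<open>Cyclically decreasing elements\<close>

text \<open>The end of the block of \<open>k\<close>: a block stops at the first position whose
  residue is missing from \<open>J\<close>.\<close>

definition cyc_next :: "nat \<Rightarrow> int set \<Rightarrow> int \<Rightarrow> int" where
  "cyc_next n J k = k + int (LEAST d. (k + int d) mod int n \<notin> J)"

text \<open>The start of the block of \<open>k\<close>; the extra \<open>- 1\<close> appears because
  a position starts a block when its predecessor has a residue outside \<open>J\<close>.\<close>

definition cyc_prev :: "nat \<Rightarrow> int set \<Rightarrow> int \<Rightarrow> int" where
  "cyc_prev n J k = k - int (LEAST d. (k - 1 - int d) mod int n \<notin> J)"

text \<open>The closed form of w_J that replaces the \<open>THE\<close> in
  \<open>cyc_elt\<close>.\<close>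

definition cyc_map :: "nat \<Rightarrow> int set \<Rightarrow> int \<Rightarrow> int" where
  "cyc_map n J k = (if (k - 1) mod int n \<in> J then k - 1 else cyc_next n J k)"

text \<open>Properness of \<open>J\<close> is what bounds the blocks: a missing residue
  \<open>c\<close> is met after \<open>(c - k) mod int n\<close> steps.\<close>

lemma ex_residue_notin:
  fixes k :: int
  assumes "J \<subset> {0..<int n}"
  shows "\<exists>d < n. (k + int d) mod int n \<notin> J"
proof -
  obtain c where c: "c \<in> {0..<int n}" "c \<notin> J" using assms by blast
  define d where "d = nat ((c - k) mod int n)"
  have "0 < int n" using c by auto
  then have "int d = (c - k) mod int n" "int d < int n" by (simp_all add: d_def)
  moreover have "(k + (c - k) mod int n) mod int n = c"
    using c by (simp add: mod_add_right_eq)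
  ultimately show ?thesis using c by (metis of_nat_less_iff)
qed

lemma cyc_next_eqI:
  assumes "k \<le> q" "q mod int n \<notin> J" "\<And>y. k \<le> y \<Longrightarrow> y < q \<Longrightarrow> y mod int n \<in> J"
  shows "cyc_next n J k = q"
proof -
  have "(LEAST d. (k + int d) mod int n \<notin> J) = nat (q - k)"
  proof (rule Least_equality)
    fix d assume "(k + int d) mod int n \<notin> J"
    then have "\<not> k + int d < q" using assms(3) [of "k + int d"] by auto
    then show "nat (q - k) \<le> d" by simp
  qed (use assms in simp)
  then show ?thesis using assms(1) by (simp add: cyc_next_def)
qed

lemma cyc_next:
  assumes "J \<subset> {0..<int n}"
  shows "k \<le> cyc_next n J k" "cyc_next n J k < k + int n" "cyc_next n J k mod int n \<notin> J"
    and "k \<le> y \<Longrightarrow> y < cyc_next n J k \<Longrightarrow> y mod int n \<in> J"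
proof -
  obtain d where d: "d < n" "(k + int d) mod int n \<notin> J" using ex_residue_notin [OF assms] by blast
  show "k \<le> cyc_next n J k" by (simp add: cyc_next_def)
  show "cyc_next n J k mod int n \<notin> J"
    unfolding cyc_next_def by (rule LeastI) (rule d(2))
  show "cyc_next n J k < k + int n"
    unfolding cyc_next_def using Least_le [of "\<lambda>d. (k + int d) mod int n \<notin> J", OF d(2)] d(1) by simp
  assume y: "k \<le> y" "y < cyc_next n J k"
  then have "nat (y - k) < (LEAST d. (k + int d) mod int n \<notin> J)"
    unfolding cyc_next_def by linarith
  from not_less_Least [OF this] show "y mod int n \<in> J" using y(1) by simp
qed

lemma cyc_prev_eqI:
  assumes "s \<le> k" "(s - 1) mod int n \<notin> J" "\<And>y. s \<le> y \<Longrightarrow> y < k \<Longrightarrow> y mod int n \<in> J"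
  shows "cyc_prev n J k = s"
proof -
  have "(LEAST d. (k - 1 - int d) mod int n \<notin> J) = nat (k - s)"
  proof (rule Least_equality)
    fix d assume "(k - 1 - int d) mod int n \<notin> J"
    then have "\<not> s \<le> k - 1 - int d" using assms(3) [of "k - 1 - int d"] by auto
    then show "nat (k - s) \<le> d" by simp
  qed (use assms in simp)
  then show ?thesis using assms(1) by (simp add: cyc_prev_def)
qed

lemma cyc_prev:
  assumes "J \<subset> {0..<int n}"
  shows "cyc_prev n J k \<le> k" "(cyc_prev n J k - 1) mod int n \<notin> J"
    and "cyc_prev n J k \<le> y \<Longrightarrow> y < k \<Longrightarrow> y mod int n \<in> J"
proof -
  have "\<exists>d. (k - 1 - int d) mod int n \<notin> J"
  proof -
    obtain d where d: "d < n" "(k + int d) mod int n \<notin> J" using ex_residue_notin [OF assms] by blast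
    \<comment> \<open>Going back from \<open>k - 1\<close> by \<open>n - 1 - d\<close> reaches
      \<open>k + d\<close> moved back by one period.\<close>
    have "k - 1 - int (n - 1 - d) = k + int d - int n" using d(1) by auto
    then have "(k - 1 - int (n - 1 - d)) mod int n = (k + int d) mod int n"
      by (simp only: minus_mod_self2)
    then have "(k - 1 - int (n - 1 - d)) mod int n \<notin> J" using d(2) by simp
    then show ?thesis ..
  qed
  from LeastI_ex [OF this] show "(cyc_prev n J k - 1) mod int n \<notin> J"
    by (simp add: cyc_prev_def algebra_simps)
  show "cyc_prev n J k \<le> k" by (simp add: cyc_prev_def)
  assume y: "cyc_prev n J k \<le> y" "y < k"
  then have "nat (k - 1 - y) < (LEAST d. (k - 1 - int d) mod int n \<notin> J)"
    unfolding cyc_prev_def by linarith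
  from not_less_Least [OF this] show "y mod int n \<in> J" using y(2) by simp
qed

text \<open>A block with start s has at most \<open>n\<close> elements: otherwise s - 1 + n would
  lie in it before its end and have a residue in \<open>J\<close>, although s - 1 has not.\<close>

lemma cyc_next_less_cyc_prev:
  assumes "J \<subset> {0..<int n}"
  shows "cyc_next n J k < cyc_prev n J k + int n"
proof (rule ccontr)
  let ?y = "cyc_prev n J k - 1 + int n"
  assume "\<not> ?thesis"
  then have "?y < cyc_next n J k" "cyc_prev n J k \<le> ?y" using assms by auto
  then have "?y mod int n \<in> J"
    using cyc_next(4) [OF assms, of k ?y] cyc_prev(3) [OF assms, of k ?y] by linarith
  then show False using cyc_prev(2) [OF assms, of k] by simp
qed

lemma periodic_cyc_map: "periodic n (cyc_map n J)"
proof -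
  have "(k + int n + int d) mod int n = (k + int d) mod int n" for k d
    by (metis add.commute add.left_commute mod_add_self2)
  moreover have "(k + int n - 1) mod int n = (k - 1) mod int n" for k
    by (metis add_diff_eq diff_add_eq mod_add_self2)
  ultimately show ?thesis by (simp add: periodic_def cyc_map_def cyc_next_def)
qed

text \<open>For \<open>J - {x}\<close> the residue \<open>x\<close> ends a block and
  \<open>x + 1\<close> forms a singleton block. Left multiplication by s_x exchanges the values in
  these two residue classes, and this merges the two blocks.\<close>

lemma sgen_cyc_map:
  assumes n: "2 \<le> n" and J: "J \<subset> {0..<int n}" and x: "x \<in> J" "(x + 1) mod int n \<notin> J"
  shows "sgen n x \<circ> cyc_map n (J - {x}) = cyc_map n J"
proof
  fix k
  let ?J = "J - {x}" and ?q = "cyc_next n (J - {x}) k"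
  have J': "?J \<subset> {0..<int n}" using J by blast
  have xm: "x mod int n = x" using J x(1) by (intro mod_pos_pos_trivial) auto
  have sgen: "sgen n x y = (if y mod int n = x then y + 1
      else if y mod int n = (x + 1) mod int n then y - 1 else y)" for y
    by (simp add: sgen_def transp_def xm)
  have ne: "(x + 1) mod int n \<noteq> x" using mod_Suc_neq(2) [OF n, of x] xm by simp
  have Suc: "(y + 1) mod int n = (x + 1) mod int n" if "y mod int n = x" for y
    using that by (metis mod_add_left_eq)
  note q = cyc_next [OF J', of k]
  show "(sgen n x \<circ> cyc_map n ?J) k = cyc_map n J k"
  proof (cases "(k - 1) mod int n \<in> ?J")
    case True
    then show ?thesis using x by (auto simp: cyc_map_def sgen)
  next
    case start: False
    show ?thesis
    proof (cases "(k - 1) mod int n = x")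
      case True
      then have k: "k mod int n = (x + 1) mod int n" using Suc [OF True] by simp
      then have "?q = k" using x(2) by (intro cyc_next_eqI) auto
      then show ?thesis using k True start x(1) ne by (simp add: cyc_map_def sgen)
    next
      case False
      then have start': "(k - 1) mod int n \<notin> J" using start by blast
      show ?thesis
      proof (cases "?q mod int n = x")
        case True
        have "cyc_next n J k = ?q + 1"
        proof (rule cyc_next_eqI)
          show "(?q + 1) mod int n \<notin> J" using Suc [OF True] x(2) by simp
          show "y mod int n \<in> J" if "k \<le> y" "y < ?q + 1" for y
            using that q(4) [of y] True x(1) by (cases "y = ?q") auto
        qed (use q in simp)
        then show ?thesis using start start' True by (simp add: cyc_map_def sgen)
      next
        case qx: False
        \<comment> \<open>A block ending in the class of \<open>x + 1\<close> is a singleton, since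
          \<open>x\<close> is missing from \<open>J - {x}\<close>; that case was treated
          above.\<close>
        have q': "?q mod int n \<noteq> (x + 1) mod int n"
        proof
          assume *: "?q mod int n = (x + 1) mod int n"
          then have **: "(?q - 1) mod int n = x" using xm by (metis add_diff_cancel_right' mod_diff_left_eq)
          then have "?q \<noteq> k" using False by auto
          then have "(?q - 1) mod int n \<in> ?J" using q(1) by (intro q(4)) auto
          then show False using ** by simp
        qed
        have "cyc_next n J k = ?q" using q qx by (intro cyc_next_eqI) auto
        then show ?thesis using start start' qx q' by (simp add: cyc_map_def sgen)
      qed
    qed
  qed
qed

lemma cyc_decreasing_Cons:
  assumes "2 \<le> n"
  shows "cyc_decreasing n (x # xs) \<longleftrightarrow> x \<in> {0..<int n} \<and> x \<notin> set xs \<and>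
    (x + 1) mod int n \<notin> set xs \<and> cyc_decreasing n xs"
proof -
  have ne: "(x + 1) mod int n \<noteq> x" if "x \<in> {0..<int n}"
    using mod_Suc_neq(2) [OF assms, of x] that by simp
  have all: "(\<forall>p < length (x # xs). P p) \<longleftrightarrow> P 0 \<and> (\<forall>p < length xs. P (Suc p))" for P
    using All_less_Suc2 by simp
  show ?thesis unfolding cyc_decreasing_def all using ne
    by (auto simp: in_set_conv_nth)
qed

text \<open>Each letter at the front merges two blocks by \<open>sgen_cyc_map\<close>. The result
  depends only on the set of letters, which yields the uniqueness behind
  \<open>cyc_elt\<close>.\<close>

lemma word_prod_cyc_decreasing:
  assumes "2 \<le> n"
  shows "cyc_decreasing n xs \<Longrightarrow> set xs \<subset> {0..<int n} \<Longrightarrow> word_prod n xs = cyc_map n (set xs)"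
proof (induction xs)
  case Nil
  have "cyc_next n {} k = k" for k by (rule cyc_next_eqI) auto
  then show ?case by (simp add: cyc_map_def fun_eq_iff)
next
  case (Cons x xs)
  then have *: "x \<in> {0..<int n}" "x \<notin> set xs" "(x + 1) mod int n \<notin> set xs" "cyc_decreasing n xs"
    using cyc_decreasing_Cons [OF assms] by auto
  have "(x + 1) mod int n \<noteq> x" using mod_Suc_neq(2) [OF assms, of x] *(1) by simp
  then have "sgen n x \<circ> cyc_map n (set (x # xs) - {x}) = cyc_map n (set (x # xs))"
    using * Cons.prems(2) by (intro sgen_cyc_map assms) auto
  moreover have "set (x # xs) - {x} = set xs" using * by auto
  moreover have "set xs \<subset> {0..<int n}" using Cons.prems(2) by auto
  ultimately show ?case using Cons.IH * by (simp del: o_apply)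
qed

lemma ex_cyc_decreasing:
  assumes "2 \<le> n"
  shows "J \<subset> {0..<int n} \<Longrightarrow> \<exists>xs. cyc_decreasing n xs \<and> set xs = J"
proof (induction "card J" arbitrary: J)
  case 0
  then have "J = {}" using finite_subset [of J "{0..<int n}"] by auto
  then show ?case by (intro exI [of _ "[]"]) (simp add: cyc_decreasing_def)
next
  case (Suc c)
  then obtain y where y: "y \<in> J" by (metis card.empty ex_in_conv nat.distinct(1))
  let ?q = "cyc_next n J y"
  note q = cyc_next [OF Suc.prems, of y]
  \<comment> \<open>The residue just before a block end can serve as first letter, since its
    successor is not in \<open>J\<close>.\<close>
  define x where "x = (?q - 1) mod int n"
  have "y mod int n \<in> J" using y Suc.prems by (metis atLeastLessThan_iff mod_pos_pos_trivial psubsetD)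
  then have "?q \<noteq> y" using q(3) by metis
  then have x: "x \<in> J" unfolding x_def using q(1) by (intro q(4)) auto
  have x': "(x + 1) mod int n \<notin> J" using q(3) by (simp add: x_def mod_add_left_eq)
  have "card (J - {x}) = c" "J - {x} \<subset> {0..<int n}" using x Suc by auto
  then obtain xs where "cyc_decreasing n xs" "set xs = J - {x}" using Suc.hyps(1) by blast
  then have "cyc_decreasing n (x # xs) \<and> set (x # xs) = J"
    using x x' Suc.prems by (auto simp: cyc_decreasing_Cons [OF assms])
  then show ?case ..
qed

lemma cyc_elt_eq:
  assumes "2 \<le> n" "J \<subset> {0..<int n}"
  shows "cyc_elt n J = cyc_map n J"
  unfolding cyc_elt_def
proof (rule the_equality)
  obtain xs where "cyc_decreasing n xs" "set xs = J" using ex_cyc_decreasing [OF assms] by blast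
  moreover from this have "word_prod n xs = cyc_map n J"
    using word_prod_cyc_decreasing [OF assms(1)] assms(2) by blast
  ultimately show "cyc_map n J \<in> affine_sym n \<and>
      (\<exists>is. cyc_decreasing n is \<and> set is = J \<and> word_prod n is = cyc_map n J)"
    using word_prod_in_affine_sym [OF assms(1)] by metis
qed (use word_prod_cyc_decreasing [OF assms(1)] assms(2) in blast)

section \<open>The action of a letter\<close>

lemma mod_neq_if_close:
  fixes x y :: int
  assumes "y < x" "x < y + n"
  shows "x mod n \<noteq> y mod n" "y mod n \<noteq> x mod n"
proof -
  have "\<not> n dvd x - y" using assms by (intro zdvd_not_zless) auto
  then show "x mod n \<noteq> y mod n" by (simp add: mod_eq_dvd_iff)
  then show "y mod n \<noteq> x mod n" by simp
qed

text \<open>The exchange sends \<open>i\<close> to \<open>j - 1\<close> and \<open>j\<close> to the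
  old block end, which is the effect of cutting the block between \<open>j - 1\<close> and
  \<open>j\<close>. All other blocks stay as they are.\<close>

lemma cyc_map_transp:
  assumes J: "J \<subset> {0..<int n}" and i: "(i - 1) mod int n \<notin> J" and ij: "i < j" "j \<le> cyc_next n J i"
  shows "cyc_map n J \<circ> transp n i j = cyc_map n (J - {(j - 1) mod int n})" (is "?v = cyc_map n ?J")
proof
  fix x
  note q = cyc_next [OF J, of i]
  have i': "(i - 1) mod int n \<notin> ?J" using i by blast
  have j: "(j - 1) mod int n \<in> J" using ij by (intro q(4)) auto
  have nij: "i mod int n \<noteq> j mod int n" using ij q(2) by (intro mod_neq_if_close) auto
  have v: "periodic n ?v" by (rule periodic_comp [OF periodic_cyc_map periodic_transp])
  have shift: "?v x = cyc_map n ?J x" if "x mod int n = y mod int n" "?v y = cyc_map n ?J y" for y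
    using periodic_mod_cong [OF v that(1)] periodic_mod_cong [OF periodic_cyc_map that(1), of ?J]
      that(2) by simp
  have vi: "?v i = cyc_map n ?J i"
  proof -
    have "cyc_next n ?J i = j - 1"
    proof (rule cyc_next_eqI)
      \<comment> \<open>The positions of a block are pairwise incongruent, so inside it only
        \<open>j - 1\<close> loses its residue.\<close>
      show "y mod int n \<in> ?J" if "i \<le> y" "y < j - 1" for y
        using that q(4) [of y] q(2) ij mod_neq_if_close(2) [of y "j - 1" "int n"] by simp
    qed (use ij in auto)
    then have "cyc_map n ?J i = j - 1" using i' by (simp only: cyc_map_def if_False)
    then show ?thesis using j by (simp add: cyc_map_def)
  qed
  have vj: "?v j = cyc_map n ?J j"
  proof -
    have "cyc_next n ?J j = cyc_next n J i"
    proof (rule cyc_next_eqI)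
      show "y mod int n \<in> ?J" if "j \<le> y" "y < cyc_next n J i" for y
        using that q(4) [of y] q(2) ij mod_neq_if_close(1) [of "j - 1" y "int n"] by simp
    qed (use ij q in auto)
    then show ?thesis using i nij by (simp add: cyc_map_def)
  qed
  show "?v x = cyc_map n ?J x"
  proof (cases "x mod int n = i mod int n \<or> x mod int n = j mod int n")
    case True
    then show ?thesis using shift vi vj by blast
  next
    case False
    then have vx: "?v x = cyc_map n J x" by (simp add: transp_def)
    have x1: "(x - 1) mod int n \<noteq> (j - 1) mod int n"
      using False by (metis diff_add_cancel mod_add_left_eq)
    show ?thesis
    proof (cases "(x - 1) mod int n \<in> J")
      case True
      then show ?thesis using x1 vx by (simp add: cyc_map_def)
    next
      case start: False
      note r = cyc_next [OF J, of x]
      have "y mod int n \<noteq> (j - 1) mod int n" if y: "x \<le> y" "y < cyc_next n J x" for y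
      proof
        assume "y mod int n = (j - 1) mod int n"
        then obtain k where k: "y = j - 1 + int n * k" by (rule mod_eq_shift)
        \<comment> \<open>Both \<open>x\<close> and \<open>i + int n * k\<close> would be the start of the block containing \<open>y\<close>.\<close>
        have "x = cyc_prev n J y"
          using y start r(4) by (intro cyc_prev_eqI [symmetric]) auto
        also have "\<dots> = i + int n * k"
        proof (rule cyc_prev_eqI)
          have "i + int n * k - 1 = i - 1 + int n * k" by simp
          then show "(i + int n * k - 1) mod int n \<notin> J" using i by (simp only: mod_mult_self2 not_False_eq_True)
          show "z mod int n \<in> J" if "i + int n * k \<le> z" "z < y" for z
          proof -
            have "(z - int n * k) mod int n \<in> J" using that k ij by (intro q(4)) auto
            moreover have "(z - int n * k) mod int n = z mod int n"
              using mod_mult_self2 [of "z - int n * k" "int n" k] by simp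
            ultimately show ?thesis by simp
          qed
        qed (use k ij in simp)
        finally show False using False by simp
      qed
      then have "cyc_next n ?J x = cyc_next n J x"
        using r by (intro cyc_next_eqI) auto
      then show ?thesis using start vx by (simp add: cyc_map_def)
    qed
  qed
qed

text \<open>A block of b elements contributes b - 1, all from its start. The induction cuts off the
  first element \<open>i\<close> of a block with end q: the contribution q - i of \<open>i\<close>
  is replaced by q - (i + 1), now coming from \<open>i + 1\<close>.\<close>

lemma excedance_cyc_map:
  assumes "2 \<le> n"
  shows "J \<subset> {0..<int n} \<Longrightarrow> excedance n (cyc_map n J) = int (card J)"
proof (induction "card J" arbitrary: J)
  case 0
  then have "J = {}" using finite_subset [of J "{0..<int n}"] by auto
  moreover have "cyc_map n {} = id"
    using word_prod_cyc_decreasing [OF assms, of "[]"] assms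
    by (simp add: cyc_decreasing_def psubset_eq)
  ultimately show ?case by (simp add: excedance_def)
next
  case (Suc c)
  note J = Suc.prems
  obtain y where y: "y \<in> J" using Suc by (metis card.empty ex_in_conv nat.distinct(1))
  have "y mod int n \<in> J" using y J by (metis atLeastLessThan_iff mod_pos_pos_trivial psubsetD)
  define i where "i = cyc_prev n J y"
  have i: "i mod int n \<in> J"
    using cyc_prev(1) [OF J, of y] cyc_prev(3) [OF J, of y i] \<open>y mod int n \<in> J\<close>
    unfolding i_def by (cases "cyc_prev n J y = y") auto
  have start: "(i - 1) mod int n \<notin> J" using cyc_prev(2) [OF J] by (simp add: i_def)
  have q: "i + 1 \<le> cyc_next n J i"
    using cyc_next(1,3) [OF J, of i] i by (cases "cyc_next n J i = i") auto
  have "cyc_map n J \<circ> transp n i (i + 1) = cyc_map n (J - {i mod int n})"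
    using cyc_map_transp [OF J start _ q] by simp
  moreover have "excedance n (cyc_map n (J - {i mod int n})) = int (card (J - {i mod int n}))"
    using Suc i by (intro Suc.hyps(1)) auto
  moreover have "card (J - {i mod int n}) = c" using i Suc by simp
  ultimately show ?case
    using excedance_transp [OF _ periodic_cyc_map, of n i "i + 1" J] assms i start q Suc.hyps(2)
    by (simp add: mod_Suc_neq cyc_map_def del: o_apply)
qed

text \<open>A cyclically decreasing word bounds the length from above, the excedance bounds it from
  below, and the two bounds agree.\<close>

lemma len_cyc_map:
  assumes "2 \<le> n" "J \<subset> {0..<int n}"
  shows "generated n (cyc_map n J)" "len n (cyc_map n J) = card J"
proof -
  obtain xs where xs: "cyc_decreasing n xs" "set xs = J" using ex_cyc_decreasing [OF assms] by blast
  have w: "word_prod n xs = cyc_map n J"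
    using word_prod_cyc_decreasing [OF assms(1) xs(1)] xs(2) assms(2) by simp
  then show gen: "generated n (cyc_map n J)"
    using xs assms(2) by (auto simp: generated_def)
  have "length xs = card J" using xs by (auto simp: cyc_decreasing_def distinct_card)
  moreover have "len n (word_prod n xs) \<le> length xs" using xs assms(2) by (intro len_le) auto
  moreover have "int (card J) \<le> int (len n (cyc_map n J))"
    using excedance_le_len [OF assms(1) gen] excedance_cyc_map [OF assms] by simp
  ultimately show "len n (cyc_map n J) = card J" using w by simp
qed

text \<open>The length of w_J equals its excedance, and the length of the product is at least its
  excedance. A drop in length thus forces a drop in excedance, an inequality between the terms at
  \<open>i\<close> and \<open>j\<close>. Conversely, cutting a block removes one residue.\<close>

lemma len_cyc_map_transp_iff:
  assumes n: "2 \<le> n" and J: "J \<subset> {0..<int n}" and ij: "i < j" "i mod int n \<noteq> j mod int n"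
  shows "len n (cyc_map n J \<circ> transp n i j) + 1 = len n (cyc_map n J) \<longleftrightarrow>
    (i - 1) mod int n \<notin> J \<and> j \<le> cyc_next n J i" (is "?L \<longleftrightarrow> ?R")
proof
  let ?w = "cyc_map n J"
  assume ?L
  moreover have "excedance n (?w \<circ> transp n i j) \<le> int (len n (?w \<circ> transp n i j))"
    using len_cyc_map(1) [OF n J] generated_transp [OF n ij]
    by (intro excedance_le_len n generated_comp)
  ultimately have "excedance n (?w \<circ> transp n i j) < excedance n ?w"
    using len_cyc_map(2) [OF n J] excedance_cyc_map [OF n J] by linarith
  then have less: "max 0 (?w j - i) + max 0 (?w i - j) < max 0 (?w i - i) + max 0 (?w j - j)"
    using excedance_transp [OF _ periodic_cyc_map ij(2)] n by (simp del: o_apply)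
  \<comment> \<open>Either alternative contradicts \<open>less\<close> when \<open>i\<close> does
    not start a block or \<open>j\<close> lies beyond the block of \<open>i\<close>.\<close>
  have wj: "?w j = j - 1 \<or> j \<le> ?w j \<and> (j - 1) mod int n \<notin> J"
    using cyc_next(1) [OF J] by (simp add: cyc_map_def)
  have "(i - 1) mod int n \<notin> J"
  proof
    assume "(i - 1) mod int n \<in> J"
    then have "?w i = i - 1" by (simp add: cyc_map_def)
    then show False using wj less ij(1) by auto
  qed
  moreover from this have wi: "?w i = cyc_next n J i" by (simp add: cyc_map_def)
  moreover have "j \<le> cyc_next n J i"
  proof (rule ccontr)
    assume "\<not> ?thesis"
    then show False using wi wj less ij(1) cyc_next(1) [OF J, of i] by auto
  qed
  ultimately show ?R by simp
next
  assume ?R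
  then have "cyc_map n J \<circ> transp n i j = cyc_map n (J - {(j - 1) mod int n})"
    and j: "(j - 1) mod int n \<in> J"
    using cyc_map_transp [OF J] cyc_next(4) [OF J, of i "j - 1"] ij by auto
  moreover have "J - {(j - 1) mod int n} \<subset> {0..<int n}" using J by blast
  moreover have "finite J" using J finite_subset [of J "{0..<int n}"] by auto
  ultimately show ?L using card_Suc_Diff1 [of J, OF _ j]
    by (simp add: len_cyc_map(2) n J del: o_apply card_Diff_insert)
qed

lemma cyc_next_cyc_prev:
  assumes "J \<subset> {0..<int n}"
  shows "cyc_next n J (cyc_prev n J a) = cyc_next n J a"
proof (rule cyc_next_eqI)
  show "y mod int n \<in> J" if "cyc_prev n J a \<le> y" "y < cyc_next n J a" for y
    using that cyc_prev(3) [OF assms, of a y] cyc_next(4) [OF assms, of a y] by linarith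
qed (use cyc_prev(1) [OF assms, of a] cyc_next [OF assms, of a] in auto)

text \<open>A block that starts at \<open>i \<le> a\<close> and reaches \<open>j > a\<close>
  contains \<open>a\<close>, so its start and end can be read off from \<open>a\<close>.\<close>

lemma block_start_iff:
  assumes "J \<subset> {0..<int n}" "i \<le> a" "a < j"
  shows "(i - 1) mod int n \<notin> J \<and> j \<le> cyc_next n J i \<longleftrightarrow>
    i = cyc_prev n J a \<and> j \<le> cyc_next n J a" (is "?L \<longleftrightarrow> ?R")
proof
  assume ?L
  then have "cyc_prev n J a = i"
    using assms cyc_next(4) [OF assms(1), of i] by (intro cyc_prev_eqI) auto
  then show ?R using \<open>?L\<close> cyc_next_cyc_prev [OF assms(1), of a] by simp
next
  assume ?R
  then show ?L using cyc_prev(2) [OF assms(1)] cyc_next_cyc_prev [OF assms(1), of a] by simp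
qed

text \<open>Of the two pieces of the cut block, the left one contains \<open>a\<close>. A later
  letter therefore meets the same start and the new end \<open>j - 1\<close>, which is why the
  second coordinates decrease strictly.\<close>

lemma cyc_next_prev_remove:
  assumes J: "J \<subset> {0..<int n}" and j: "a < j" "j \<le> cyc_next n J a"
  shows "cyc_next n (J - {(j - 1) mod int n}) a = j - 1"
    and "cyc_prev n (J - {(j - 1) mod int n}) a = cyc_prev n J a"
proof -
  show "cyc_next n (J - {(j - 1) mod int n}) a = j - 1"
  proof (rule cyc_next_eqI)
    show "y mod int n \<in> J - {(j - 1) mod int n}" if "a \<le> y" "y < j - 1" for y
      using that j cyc_next(2,4) [OF J, of a] mod_neq_if_close(2) [of y "j - 1" "int n"] by auto
  qed (use j in auto)
  show "cyc_prev n (J - {(j - 1) mod int n}) a = cyc_prev n J a"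
  proof (rule cyc_prev_eqI)
    show "y mod int n \<in> J - {(j - 1) mod int n}" if "cyc_prev n J a \<le> y" "y < a" for y
      using that j cyc_next_less_cyc_prev [OF J, of a] cyc_prev(3) [OF J, of a y]
        mod_neq_if_close(2) [of y "j - 1" "int n"] by auto
  qed (use cyc_prev [OF J, of a] in auto)
qed

section \<open>The action of a word\<close>

lemma lookup_nc_scale: "Poly_Mapping.lookup (nc_scale c f) x = c * Poly_Mapping.lookup f x"
  by (simp add: nc_scale_def Poly_Mapping.map.rep_eq when_def)

lemma nc_scale_simps [simp]:
  "nc_scale 0 f = 0" "nc_scale 1 f = f" "nc_scale c 0 = 0"
  by (simp_all add: poly_mapping_eq_iff fun_eq_iff lookup_nc_scale)

lemma nc_scale_add:
  "nc_scale (c + d) f = nc_scale c f + nc_scale d f"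
  "nc_scale c (f + g) = nc_scale c f + nc_scale c g"
  by (simp_all add: poly_mapping_eq_iff fun_eq_iff lookup_nc_scale lookup_add algebra_simps)

lemma nc_scale_sum: "nc_scale c (\<Sum>x \<in> A. f x) = (\<Sum>x \<in> A. nc_scale c (f x))"
  by (induction A rule: infinite_finite_induct) (simp_all add: nc_scale_add)

lemma act_letter_superset:
  assumes "finite A" "Poly_Mapping.keys f \<subseteq> A"
  shows "act_letter n f b =
    (\<Sum>w \<in> A. nc_scale (Poly_Mapping.lookup f w) (act_basis n w b))"
  unfolding act_letter_def using assms
  by (intro sum.mono_neutral_left) (auto simp: in_keys_iff)

lemma act_letter_0 [simp]: "act_letter n 0 b = 0"
  by (simp add: act_letter_def)

lemma act_letter_add: "act_letter n (f + g) b = act_letter n f b + act_letter n g b"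
proof -
  let ?A = "Poly_Mapping.keys f \<union> Poly_Mapping.keys g"
  have "Poly_Mapping.keys (f + g) \<subseteq> ?A" by (rule Poly_Mapping.keys_add)
  then show ?thesis
    by (simp add: act_letter_superset [of ?A] lookup_add nc_scale_add sum.distrib)
qed

lemma act_letter_sum: "act_letter n (\<Sum>x \<in> A. f x) b = (\<Sum>x \<in> A. act_letter n (f x) b)"
  by (induction A rule: infinite_finite_induct) (simp_all add: act_letter_add)

lemma act_letter_basis: "act_letter n (nc_basis w) b = act_basis n w b"
  by (simp add: act_letter_def nc_basis_def)

lemma act_word_Nil [simp]: "act_word n f [] = f"
  by (simp add: act_word_def)

lemma act_word_Cons [simp]: "act_word n f (b # u) = act_word n (act_letter n f b) u"
  by (simp add: act_word_def)

lemma act_word_0 [simp]: "act_word n 0 u = 0"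
  by (induction u) simp_all

lemma act_word_sum: "act_word n (\<Sum>x \<in> A. f x) u = (\<Sum>x \<in> A. act_word n (f x) u)"
  by (induction u arbitrary: f) (simp_all add: act_letter_sum)

section \<open>Letters and words acting on w_J\<close>

lemma act_letter_cyc_map:
  assumes "2 \<le> n" "J \<subset> {0..<int n}" "i \<le> a" "a < j" "i mod int n \<noteq> j mod int n"
  shows "act_letter n (nc_basis (cyc_map n J)) (i, j) =
    (if i = cyc_prev n J a \<and> j \<le> cyc_next n J a
     then nc_basis (cyc_map n (J - {(j - 1) mod int n})) else 0)"
proof -
  have ij: "i < j" using assms by simp
  note iff = len_cyc_map_transp_iff [OF assms(1,2) ij assms(5)] block_start_iff [OF assms(2-4)]
  show ?thesis
  proof (cases "i = cyc_prev n J a \<and> j \<le> cyc_next n J a")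
    case True
    then have "cyc_map n J \<circ> transp n i j = cyc_map n (J - {(j - 1) mod int n})"
      using cyc_map_transp [OF assms(2) _ ij] iff(2) by blast
    then show ?thesis using True iff by (simp add: act_letter_basis act_basis_def)
  next
    case False
    then show ?thesis using iff by (simp only: act_letter_basis act_basis_def prod.case if_False)
  qed
qed

text \<open>Induction along the word while \<open>J\<close> shrinks: the block start stays fixed,
  and the bound for each second coordinate is the block end left by the previous letter.\<close>

lemma act_word_cyc_map:
  assumes n: "2 \<le> n"
  shows "J \<subset> {0..<int n} \<Longrightarrow> \<forall>(i, j) \<in> set u. i \<le> a \<and> a < j \<and> i mod int n \<noteq> j mod int n \<Longrightarrow>
    act_word n (nc_basis (cyc_map n J)) u =
    (if fst ` set u \<subseteq> {cyc_prev n J a} \<and> sorted_wrt (>) (map snd u) \<and>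
        snd ` set u \<subseteq> {a<..cyc_next n J a}
     then nc_basis (cyc_map n (J - (\<lambda>j. (j - 1) mod int n) ` snd ` set u)) else 0)"
proof (induction u arbitrary: J)
  case (Cons b u)
  obtain i j where b: "b = (i, j)" by fastforce
  have ij: "i \<le> a" "a < j" "i mod int n \<noteq> j mod int n" using Cons.prems(2) b by auto
  let ?J = "J - {(j - 1) mod int n}"
  have J': "?J \<subset> {0..<int n}" using Cons.prems(1) by blast
  note letter = act_letter_cyc_map [OF n Cons.prems(1) ij]
  show ?case
  proof (cases "i = cyc_prev n J a \<and> j \<le> cyc_next n J a")
    case True
    then have j: "j \<le> cyc_next n J a" by simp
    have "J - (\<lambda>j. (j - 1) mod int n) ` snd ` set (b # u) =
        ?J - (\<lambda>j. (j - 1) mod int n) ` snd ` set u"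
      by (auto simp: b)
    \<comment> \<open>After the first letter the block ends at \<open>j - 1\<close>; as a bound for
      the tail this combines the strict decrease below \<open>j\<close> with the original
      bound.\<close>
    moreover have "snd ` set u \<subseteq> {a<..j - 1} \<and> sorted_wrt (>) (map snd u) \<longleftrightarrow>
        sorted_wrt (>) (map snd (b # u)) \<and> snd ` set (b # u) \<subseteq> {a<..cyc_next n J a}"
    proof -
      have "snd ` set u \<subseteq> {a<..j - 1} \<longleftrightarrow>
          (\<forall>y \<in> snd ` set u. y < j) \<and> snd ` set u \<subseteq> {a<..cyc_next n J a}"
        using j by fastforce
      then show ?thesis using j ij(2) by (simp add: b) blast
    qed
    moreover have "fst ` set (b # u) \<subseteq> {cyc_prev n J a} \<longleftrightarrow> fst ` set u \<subseteq> {cyc_prev n J a}"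
      using True by (simp add: b)
    moreover have "act_word n (nc_basis (cyc_map n J)) (b # u) = act_word n (nc_basis (cyc_map n ?J)) u"
      using letter True by (simp add: b)
    moreover have "\<forall>(i, j) \<in> set u. i \<le> a \<and> a < j \<and> i mod int n \<noteq> j mod int n"
      using Cons.prems(2) by simp
    note Cons.IH [OF J' this, unfolded cyc_next_prev_remove [OF Cons.prems(1) ij(2) j]]
    ultimately show ?thesis by (simp only: conj_commute [of "sorted_wrt _ _"])
  next
    case False
    then show ?thesis using letter by (auto simp: b)
  qed
qed simp

section \<open>Stars\<close>

text \<open>The bound \<open>s + int n\<close> puts all vertices into one period, so their residues
  are distinct. Every edge contains the centre \<open>s\<close>, which rules out cycles.\<close>

lemma connected_tree_star:
  assumes "finite T" "T \<noteq> {}" "s \<le> a" "T \<subseteq> {a<..<s + int n}"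
  shows "connected_tree n a ({s} \<times> T)"
proof -
  let ?D = "{s} \<times> T"
  have verts: "verts ?D = insert s T" using assms(2) by (auto simp: verts_def)
  have "(x, s) \<in> (adj ?D)\<^sup>*" "(s, x) \<in> (adj ?D)\<^sup>*" if "x \<in> verts ?D" for x
    using that by (auto simp: verts adj_def)
  then have "graph_connected ?D" unfolding graph_connected_def by (meson rtrancl_trans)
  moreover have "\<not> graph_cycle ?D vs" for vs
  proof
    assume "graph_cycle ?D vs"
    then have len: "3 \<le> length vs" and dist: "distinct vs"
      and step: "\<And>k. Suc k < length vs \<Longrightarrow> (vs ! k, vs ! Suc k) \<in> adj ?D"
      and closing: "(last vs, hd vs) \<in> adj ?D"
      by (auto simp: graph_cycle_def)
    have centre: "s = x \<or> s = y" if "(x, y) \<in> adj ?D" for x y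
      using that by (auto simp: adj_def)
    \<comment> \<open>The first two edges force the centre to be \<open>vs ! 1\<close>, which the
      closing edge avoids.\<close>
    have "s = vs ! 0 \<or> s = vs ! 1" "s = vs ! 1 \<or> s = vs ! 2"
      using centre [OF step [of 0]] centre [OF step [of 1]] len by (auto simp: numeral_2_eq_2)
    moreover have "s = vs ! (length vs - 1) \<or> s = vs ! 0"
    proof -
      have "vs \<noteq> []" using len by auto
      then show ?thesis using centre [OF closing] by (simp add: last_conv_nth hd_conv_nth)
    qed
    moreover have ne: "vs ! p \<noteq> vs ! q" if "p < length vs" "q < length vs" "p \<noteq> q" for p q
      using dist that by (simp add: nth_eq_iff_index_eq)
    have "vs ! 0 \<noteq> vs ! 1" "vs ! 0 \<noteq> vs ! 2" "vs ! 1 \<noteq> vs ! 2" "vs ! 1 \<noteq> vs ! (length vs - 1)"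
      using len by - (rule ne; linarith)+
    ultimately show False by metis
  qed
  moreover have "inj_on (\<lambda>x. x mod int n) (verts ?D)"
  proof (rule linorder_inj_onI)
    fix x y assume "x < y" "x \<in> verts ?D" "y \<in> verts ?D"
    moreover have "verts ?D \<subseteq> {s..<s + int n}" using assms by (auto simp: verts)
    ultimately have "x \<in> {s..<s + int n}" "y \<in> {s..<s + int n}" by blast+
    then have "y < x + int n" by simp
    with \<open>x < y\<close> show "x mod int n \<noteq> y mod int n" by (intro mod_neq_if_close)
  qed auto
  ultimately show ?thesis using assms by (auto simp: connected_tree_def)
qed

text \<open>Letters with a common first coordinate never have disjoint supports, so no swap
  applies.\<close>

lemma swap_rel_star:
  assumes "\<forall>p \<in> set u. fst p = s" "(u, u') \<in> swap_rel\<^sup>*"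
  shows "u' = u"
  using assms(2)
proof (induction rule: rtrancl_induct)
  case (step y z)
  then show ?case using assms(1) by (auto simp: swap_rel_def)
qed simp

text \<open>The equivalence class of a star labeling is a singleton, so it can only be represented
  by the labeling itself.\<close>

lemma star_labeling_in_reps:
  assumes R: "mn_reps D R" and u: "u \<in> labelings D" "fst ` D = {s}" and sm: "sorted_wrt (>) (map snd u)"
  shows "u \<in> R"
proof -
  have D: "set u = D" "distinct u" using u(1) by (auto simp: labelings_def)
  have star: "\<forall>p \<in> set u. fst p = s" using u(2) D by auto
  have "swap_rel\<^sup>* `` {u} = {u}" using swap_rel_star [OF star] by auto
  then have "{u} \<in> labelings D // swap_rel\<^sup>*" using u(1) by (metis quotientI)
  \<comment> \<open>A star has a single first coordinate, so \<open>l - 1 = 0\<close>: the first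
    segment is empty and the second is the whole word.\<close>
  moreover have "mn_ordered u"
  proof -
    have "sorted (map fst u)" using star by (auto simp: sorted_iff_nth_mono)
    moreover have "distinct (map snd u)"
      using sm by (auto simp: distinct_conv_nth sorted_wrt_iff_nth_less neq_iff)
    ultimately show ?thesis using u(2) D by (simp add: mn_ordered_def)
  qed
  ultimately have "{u} \<in> mn_classes D" by (simp add: mn_classes_def)
  then show ?thesis using R by (auto simp: mn_reps_def)
qed

definition star_word :: "int \<Rightarrow> int set \<Rightarrow> (int \<times> int) list" where
  "star_word s T = map (Pair s) (rev (sorted_list_of_set T))"

lemma star_word_props:
  assumes "finite T"
  shows "set (star_word s T) = {s} \<times> T" "distinct (star_word s T)"
    and "sorted_wrt (>) (map snd (star_word s T))"
proof -
  show "set (star_word s T) = {s} \<times> T" using assms by (auto simp: star_word_def)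
  show "distinct (star_word s T)" by (simp add: star_word_def distinct_map inj_on_def)
  have "map snd (star_word s T) = rev (sorted_list_of_set T)" by (simp add: star_word_def comp_def)
  then show "sorted_wrt (>) (map snd (star_word s T))" by (simp add: sorted_wrt_rev)
qed

lemma star_word_eqI:
  assumes "fst ` set u \<subseteq> {s}" "sorted_wrt (>) (map snd u)"
  shows "u = star_word s (snd ` set u)"
proof -
  have "sorted_wrt (<) (rev (map snd u))" using assms(2) by (simp add: sorted_wrt_rev)
  then have "rev (map snd u) = sorted_list_of_set (snd ` set u)"
    by (metis list.set_map set_rev sorted_list_of_set.idem_if_sorted_distinct strict_sorted_iff)
  then have "map snd u = rev (sorted_list_of_set (snd ` set u))" by (metis rev_rev_ident)
  then have "star_word s (snd ` set u) = map (Pair s) (map snd u)" by (simp add: star_word_def)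
  also have "\<dots> = u" using assms(1) by (force intro!: map_idI)
  finally show ?thesis ..
qed

lemma mn_p_star_word:
  assumes M: "\<And>D. connected_tree n a D \<Longrightarrow> mn_reps D (M D)"
    and T: "finite T" "T \<noteq> {}" "s \<le> a" "T \<subseteq> {a<..<s + int n}"
  shows "mn_p n M (card T) a (star_word s T) = 1"
proof -
  let ?D = "{s} \<times> T"
  have tree: "connected_tree n a ?D" by (rule connected_tree_star [OF T])
  have "star_word s T \<in> M ?D"
  proof (rule star_labeling_in_reps [OF M [OF tree]])
    show "star_word s T \<in> labelings ?D" by (simp add: labelings_def star_word_props [OF T(1)])
    show "fst ` ?D = {s}" using T(2) by auto
    show "sorted_wrt (>) (map snd (star_word s T))" by (rule star_word_props(3) [OF T(1)])
  qed
  \<comment> \<open>The centre is the only low vertex, so the exponent of the sign is 0.\<close>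
  moreover have "{x \<in> verts ?D. x \<le> a} = {s}" using T by (auto simp: verts_def)
  then have "num_low a ?D = 1" by (simp add: num_low_def)
  moreover have "card ?D = card T" by (simp add: card_cartesian_product)
  ultimately show ?thesis using tree by (simp add: mn_p_def star_word_props [OF T(1)])
qed

text \<open>\<open>X\<close> collects the \<open>m\<close> smallest elements; the induction adds the
  minimum of what remains.\<close>

lemma ex_initial_segment:
  fixes C :: "'a::linorder set"
  assumes "finite C" "m \<le> card C"
  shows "\<exists>X \<subseteq> C. card X = m \<and> (\<forall>x \<in> X. \<forall>y \<in> C. y \<le> x \<longrightarrow> y \<in> X)"
  using assms(2)
proof (induction m)
  case 0
  show ?case by (intro exI [of _ "{}"]) simp
next
  case (Suc m)
  then obtain X where X: "X \<subseteq> C" "card X = m" "\<forall>x \<in> X. \<forall>y \<in> C. y \<le> x \<longrightarrow> y \<in> X" by auto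
  have fin: "finite X" "finite (C - X)" using X assms(1) finite_subset by auto
  have "C - X \<noteq> {}" 
  proof
    assume "C - X = {}"
    then have "C = X" using X(1) by blast
    then show False using X(2) Suc.prems by simp
  qed
  then have "Min (C - X) \<in> C - X" using fin by (intro Min_in)
  moreover have "\<forall>y \<in> C. y \<le> Min (C - X) \<longrightarrow> y \<in> insert (Min (C - X)) X"
  proof clarify
    fix y assume y: "y \<in> C" "y \<le> Min (C - X)" "y \<notin> X"
    then have "Min (C - X) \<le> y" using fin by simp
    with y(2) show "y = Min (C - X)" by simp
  qed
  ultimately show ?case using X fin by (intro exI [of _ "insert (Min (C - X)) X"]) auto
qed

section \<open>Recovering a cyclically decreasing element from its image\<close>

text \<open>The residues that a star with second coordinates \<open>T\<close> removes from
  \<open>J\<close>.\<close>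

definition shift_residues :: "nat \<Rightarrow> int set \<Rightarrow> int set" where
  "shift_residues n T = (\<lambda>j. (j - 1) mod int n) ` T"

text \<open>The possible sets of second coordinates of an \<open>m\<close>-letter star acting
  nontrivially on w_J; its first coordinate is fixed by \<open>J\<close> and
  \<open>a\<close>.\<close>

definition star_choices :: "nat \<Rightarrow> int \<Rightarrow> nat \<Rightarrow> int set \<Rightarrow> int set set" where
  "star_choices n a m J = {T. T \<subseteq> {a<..cyc_next n J a} \<and> card T = m}"

lemma finite_star_choices: "finite (star_choices n a m J)"
  by (rule finite_subset [of _ "Pow {a<..cyc_next n J a}"]) (auto simp: star_choices_def)

lemma inj_on_pred_mod: "inj_on (\<lambda>j. (j - 1) mod int n) {a<..a + int n}"
proof (rule linorder_inj_onI)
  fix x y assume "x < y" "x \<in> {a<..a + int n}" "y \<in> {a<..a + int n}"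
  then show "(x - 1) mod int n \<noteq> (y - 1) mod int n" by (intro mod_neq_if_close) auto
qed auto

lemma star_choices_props:
  assumes J: "J \<subset> {0..<int n}" and T: "T \<in> star_choices n a m J"
  shows "finite T" "T \<subseteq> {a<..a + int n}" "shift_residues n T \<subseteq> J" "card (shift_residues n T) = m"
proof -
  have sub: "T \<subseteq> {a<..cyc_next n J a}" "card T = m" using T by (auto simp: star_choices_def)
  then show "finite T" using finite_subset by auto
  show T': "T \<subseteq> {a<..a + int n}" using sub(1) cyc_next(2) [OF J, of a] by fastforce
  show "shift_residues n T \<subseteq> J"
    using sub(1) cyc_next(4) [OF J, of a] by (fastforce simp: shift_residues_def)
  show "card (shift_residues n T) = m"
    unfolding shift_residues_def using sub(2) inj_on_subset [OF inj_on_pred_mod T'] by (simp add: card_image)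
qed

text \<open>All positions from \<open>a\<close> to just before the block end have residues in
  \<open>J\<close>, so those missing from the remaining set are the removed ones. Thus
  \<open>T\<close> depends on \<open>J\<close> only through the remaining set and the block
  end.\<close>

lemma star_choices_eq:
  assumes J: "J \<subset> {0..<int n}" and T: "T \<in> star_choices n a m J"
  shows "T = {j \<in> {a<..cyc_next n J a}. (j - 1) mod int n \<notin> J - shift_residues n T}"
proof -
  have sub: "T \<subseteq> {a<..cyc_next n J a}" using T by (auto simp: star_choices_def)
  have "j \<in> T" if j: "j \<in> {a<..cyc_next n J a}" "(j - 1) mod int n \<notin> J - shift_residues n T" for j
  proof -
    have "(j - 1) mod int n \<in> J" using j(1) by (intro cyc_next(4) [OF J, of a]) auto
    then have "(j - 1) mod int n \<in> (\<lambda>j. (j - 1) mod int n) ` T"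
      using j(2) by (simp add: shift_residues_def)
    moreover have "j \<in> {a<..a + int n}" using j(1) cyc_next(2) [OF J, of a] by auto
    ultimately show ?thesis
      using inj_on_image_mem_iff [OF inj_on_pred_mod] star_choices_props(2) [OF J T] by blast
  qed
  moreover have "(j - 1) mod int n \<in> shift_residues n T" if "j \<in> T" for j
    using that by (simp add: shift_residues_def)
  ultimately show ?thesis using sub by blast
qed

lemma bij_betw_star_choices:
  assumes "m \<le> i" "i < n"
  shows "bij_betw (\<lambda>(J, T). J - shift_residues n T)
    (SIGMA J : {J. J \<subset> {0..<int n} \<and> card J = i}. star_choices n a m J)
    {J. J \<subset> {0..<int n} \<and> card J = i - m}"
proof (rule bij_betwI')
  fix P Q
  assume P: "P \<in> (SIGMA J : {J. J \<subset> {0..<int n} \<and> card J = i}. star_choices n a m J)"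
    and Q: "Q \<in> (SIGMA J : {J. J \<subset> {0..<int n} \<and> card J = i}. star_choices n a m J)"
  obtain J T where JT: "P = (J, T)" by fastforce
  obtain K U where KU: "Q = (K, U)" by fastforce
  have J: "J \<subset> {0..<int n}" "T \<in> star_choices n a m J" using P JT by auto
  have K: "K \<subset> {0..<int n}" "U \<in> star_choices n a m K" using Q KU by auto
  have "P = Q" if eq: "J - shift_residues n T = K - shift_residues n U"
  proof -
    note T = star_choices_eq [OF J] and U = star_choices_eq [OF K]
    \<comment> \<open>Both sets are cut out by the same residue condition up to their respective
      block ends, hence nested; equal cardinality then makes them equal.\<close>
    have "T \<subseteq> U \<or> U \<subseteq> T"
    proof (cases "cyc_next n J a \<le> cyc_next n K a")
      case True
      then have "T \<subseteq> U" by (subst T, subst U) (auto simp: eq)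
      then show ?thesis ..
    next
      case False
      then have "U \<subseteq> T" by (subst T, subst U) (auto simp: eq)
      then show ?thesis ..
    qed
    moreover have "card T = card U" using J(2) K(2) by (simp add: star_choices_def)
    moreover note star_choices_props(1) [OF J] star_choices_props(1) [OF K]
    ultimately have TU: "T = U" by (metis card_subset_eq)
    have "J = (J - shift_residues n T) \<union> shift_residues n T" using star_choices_props(3) [OF J] by blast
    also have "\<dots> = (K - shift_residues n U) \<union> shift_residues n U"
      using eq TU by simp
    also have "\<dots> = K" using star_choices_props(3) [OF K] by blast
    finally show ?thesis using TU JT KU by simp
  qed
  then show "((case P of (J, T) \<Rightarrow> J - shift_residues n T) = (case Q of (J, T) \<Rightarrow> J - shift_residues n T)) = (P = Q)"
    using JT KU by auto
next
  fix P assume P: "P \<in> (SIGMA J : {J. J \<subset> {0..<int n} \<and> card J = i}. star_choices n a m J)"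
  obtain J T where JT: "P = (J, T)" by fastforce
  have J: "J \<subset> {0..<int n}" "T \<in> star_choices n a m J" "card J = i" using P JT by auto
  have "finite J" using J(1) finite_subset [of J "{0..<int n}"] by auto
  then have "card (J - shift_residues n T) = i - m"
    using star_choices_props(3,4) [OF J(1,2)] J(3) by (metis card_Diff_subset finite_subset)
  then show "(case P of (J, T) \<Rightarrow> J - shift_residues n T) \<in> {J. J \<subset> {0..<int n} \<and> card J = i - m}"
    using J(1) JT by auto
next
  fix J' assume "J' \<in> {J. J \<subset> {0..<int n} \<and> card J = i - m}"
  then have J': "J' \<subset> {0..<int n}" "card J' = i - m" by auto
  have finJ': "finite J'" using J'(1) finite_subset [of J' "{0..<int n}"] by auto
  have n: "0 < int n" using assms by simp
  let ?f = "\<lambda>j. (j - 1) mod int n"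
  \<comment> \<open>The candidates for second coordinates, one for each residue outside
    \<open>J'\<close>.\<close>
  define C where "C = {j \<in> {a<..a + int n}. ?f j \<notin> J'}"
  have surj: "?f ` {a<..a + int n} = {0..<int n}"
  proof (rule card_subset_eq)
    show "card (?f ` {a<..a + int n}) = card {0..<int n}"
      by (simp add: card_image [OF inj_on_pred_mod])
  qed (use n in auto)
  have fC: "?f ` C = {0..<int n} - J'" unfolding C_def surj [symmetric] by blast
  have CA: "C \<subseteq> {a<..a + int n}" by (auto simp: C_def)
  have injC: "inj_on ?f C" using inj_on_subset [OF inj_on_pred_mod CA] .
  have finC: "finite C" using CA finite_subset by auto
  have "card C = card ({0..<int n} - J')" using fC card_image [OF injC] by simp
  then have "card C = n - (i - m)" using J' finJ' by (simp add: card_Diff_subset psubset_imp_subset)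
  \<comment> \<open>Strict because \<open>i < n\<close>; this leaves a residue outside
    \<open>J\<close> and so makes \<open>J\<close> a proper subset.\<close>
  then have m: "m < card C" using assms by simp
  then obtain T where T: "T \<subseteq> C" "card T = m" "\<forall>x \<in> T. \<forall>y \<in> C. y \<le> x \<longrightarrow> y \<in> T"
    using ex_initial_segment [OF finC, of m] by auto
  define J where "J = J' \<union> shift_residues n T"
  have disj: "J' \<inter> shift_residues n T = {}" using T(1) by (auto simp: shift_residues_def C_def)
  have "T \<subset> C" using T m by auto
  then have "shift_residues n T \<subset> {0..<int n} - J'"
    unfolding shift_residues_def fC [symmetric]
    by (rule image_strict_mono [OF injC])
  then have J: "J \<subset> {0..<int n}" using J'(1) by (auto simp: J_def)
  have "card (shift_residues n T) = m"
    unfolding shift_residues_def using card_image [OF inj_on_subset [OF injC T(1)]] T(2) by simp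
  moreover have "finite (shift_residues n T)"
    unfolding shift_residues_def using finite_subset [OF T(1) finC] by simp
  ultimately have card: "card J = i"
    unfolding J_def using card_Un_disjoint [OF finJ' _ disj] J'(2) assms by simp
  have "T \<in> star_choices n a m J"
  proof -
    \<comment> \<open>If \<open>j\<close> lay beyond the block end q, then q + 1 would be a
      candidate not exceeding \<open>j\<close>, hence in \<open>T\<close>, and the residue of q
      would lie in \<open>J\<close>.\<close>
    have "j \<le> cyc_next n J a" if j: "j \<in> T" for j
    proof (rule ccontr)
      assume "\<not> ?thesis"
      then have less: "cyc_next n J a + 1 \<le> j" by simp
      let ?q = "cyc_next n J a + 1"
      have "?q \<in> {a<..a + int n}" using cyc_next(1,2) [OF J, of a] by auto
      moreover have "?f ?q \<notin> J" using cyc_next(3) [OF J, of a] by simp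
      ultimately have "?q \<in> C" by (simp add: C_def J_def)
      then have "?q \<in> T" using T(3) j less by blast
      then have "?f ?q \<in> J" unfolding J_def shift_residues_def by blast
      with \<open>?f ?q \<notin> J\<close> show False ..
    qed
    then show ?thesis using T CA by (auto simp: star_choices_def)
  qed
  moreover have "J' = J - shift_residues n T" using disj by (auto simp: J_def)
  ultimately show "\<exists>P \<in> (SIGMA J : {J. J \<subset> {0..<int n} \<and> card J = i}. star_choices n a m J).
      J' = (case P of (J, T) \<Rightarrow> J - shift_residues n T)"
    using J card by (intro bexI [of _ "(J, T)"]) auto
qed

section \<open>Murnaghan-Nakayama elements acting on cyclically decreasing elements\<close>

text \<open>Written as an indicator sum over \<open>T\<close> that is valid for every word
  \<open>u\<close>, which prepares the interchange with the sum over all words.\<close>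

lemma scaled_act_word_cyc_map:
  assumes n: "2 \<le> n" and m: "1 \<le> m" and J: "J \<subset> {0..<int n}"
    and M: "\<And>D. connected_tree n a D \<Longrightarrow> mn_reps D (M D)"
  shows "nc_scale (mn_p n M m a u) (act_word n (nc_basis (cyc_map n J)) u) =
    (\<Sum>T \<in> star_choices n a m J. if u = star_word (cyc_prev n J a) T
      then nc_basis (cyc_map n (J - shift_residues n T)) else 0)" (is "?lhs = (\<Sum>T \<in> ?C. ?g T)")
proof -
  let ?s = "cyc_prev n J a"
  have star: "mn_p n M m a (star_word ?s T) = 1 \<and>
      act_word n (nc_basis (cyc_map n J)) (star_word ?s T) = nc_basis (cyc_map n (J - shift_residues n T))"
    if T: "T \<in> ?C" for T
  proof
    have sub: "T \<subseteq> {a<..cyc_next n J a}" "card T = m" using T by (auto simp: star_choices_def)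
    have fin: "finite T" by (rule star_choices_props(1) [OF J T])
    \<comment> \<open>The block of \<open>a\<close> has at most \<open>n\<close> elements, which
      gives the star the distinct residues required of a tree.\<close>
    have win: "T \<subseteq> {a<..<?s + int n}" using sub(1) cyc_next_less_cyc_prev [OF J, of a] by fastforce
    have s: "?s \<le> a" by (rule cyc_prev(1) [OF J])
    show "mn_p n M m a (star_word ?s T) = 1"
      using mn_p_star_word [OF M fin _ s win] sub(2) m by fastforce
    have "?s mod int n \<noteq> j mod int n" if "j \<in> T" for j
      using win that s by (intro mod_neq_if_close) auto
    then show "act_word n (nc_basis (cyc_map n J)) (star_word ?s T) =
        nc_basis (cyc_map n (J - shift_residues n T))"
      using sub win s star_word_props [OF fin, of ?s]
      by (subst act_word_cyc_map [OF n J, of _ a]) (auto simp: shift_residues_def snd_image_times)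
  qed
  show ?thesis
  proof (cases "\<exists>T \<in> ?C. u = star_word ?s T")
    case True
    then obtain T where T: "T \<in> ?C" "u = star_word ?s T" by blast
    \<comment> \<open>Different sets give different words, so at most one summand can be
      nonzero.\<close>
    have "U = T" if "U \<in> ?C" "u = star_word ?s U" for U
    proof -
      have "{?s} \<times> U = {?s} \<times> T"
        using that T star_word_props(1) star_choices_props(1) [OF J] by metis
      then show ?thesis by auto
    qed
    then have "(\<Sum>U \<in> ?C. ?g U) = (\<Sum>U \<in> ?C. if U = T then nc_basis (cyc_map n (J - shift_residues n U)) else 0)"
      using T by (intro sum.cong) auto
    also have "\<dots> = nc_basis (cyc_map n (J - shift_residues n T))"
      using T(1) finite_star_choices by simp
    finally show ?thesis using star [OF T(1)] T(2) by simp
  next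
    case False
    then have "(\<Sum>T \<in> ?C. ?g T) = 0" by (intro sum.neutral) auto
    moreover have "?lhs = 0"
    proof (cases "mn_p n M m a u = 0")
      case False
      then have tree: "connected_tree n a (set u)" and card: "card (set u) = m" and u: "u \<in> M (set u)"
        by (auto simp: mn_p_def split: if_splits)
      have letters: "\<forall>(i, j) \<in> set u. i \<le> a \<and> a < j \<and> i mod int n \<noteq> j mod int n"
      proof clarify
        fix i j assume ij: "(i, j) \<in> set u"
        then have "i \<le> a" "a < j" using tree by (auto simp: connected_tree_def)
        moreover have "i \<in> verts (set u)" "j \<in> verts (set u)" using ij by (force simp: verts_def)+
        then have "i mod int n \<noteq> j mod int n" if "i \<noteq> j"
          using tree that by (auto simp: connected_tree_def inj_on_def)
        ultimately show "i \<le> a \<and> a < j \<and> i mod int n \<noteq> j mod int n" by auto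
      qed
      have "\<not> (fst ` set u \<subseteq> {?s} \<and> sorted_wrt (>) (map snd u) \<and>
          snd ` set u \<subseteq> {a<..cyc_next n J a})"
      proof
        assume *: "fst ` set u \<subseteq> {?s} \<and> sorted_wrt (>) (map snd u) \<and>
          snd ` set u \<subseteq> {a<..cyc_next n J a}"
        then have "u = star_word ?s (snd ` set u)" by (intro star_word_eqI) auto
        moreover have "inj_on snd (set u)" 
        proof (rule inj_onI)
          fix p q assume "p \<in> set u" "q \<in> set u" "snd p = snd q"
          moreover from this have "fst p = ?s" "fst q = ?s" using * by auto
          ultimately show "p = q" by (simp add: prod_eq_iff)
        qed
        then have "snd ` set u \<in> ?C" using * card by (simp add: star_choices_def card_image)
        ultimately show False using \<open>\<not> (\<exists>T \<in> ?C. u = star_word ?s T)\<close> by blast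
      qed
      then have "act_word n (nc_basis (cyc_map n J)) u = 0"
        using act_word_cyc_map [OF n J letters] by presburger
      then show ?thesis by simp
    qed simp
    ultimately show ?thesis by simp
  qed
qed

theorem theorem5p7:
  fixes n m i :: nat and a :: int
    and M :: "(int \<times> int) set \<Rightarrow> (int \<times> int) list set"
  assumes "2 \<le> n" and "1 \<le> m" and "m \<le> i" and "i < n"
    and "\<And>D. connected_tree n a D \<Longrightarrow> mn_reps D (M D)"
  shows "D_op n (mn_p n M m a) (nc_h n i) = nc_h n (i - m)"
proof -
  define N where "N k = {J. J \<subset> {0..<int n} \<and> card J = k}" for k
  have finN: "finite (N k)" for k
    by (rule finite_subset [of _ "Pow {0..<int n}"]) (auto simp: N_def)
  have h: "nc_h n k = (\<Sum>J \<in> N k. nc_basis (cyc_map n J))" for k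
    unfolding nc_h_def N_def using cyc_elt_eq [OF assms(1)] by (intro sum.cong) auto
  define P where "P = (SIGMA J : N i. star_choices n a m J)"
  have finP: "finite P" unfolding P_def by (intro finite_SigmaI finN finite_star_choices)
  let ?word = "\<lambda>(J, T). star_word (cyc_prev n J a) T"
  let ?val = "\<lambda>(J, T). nc_basis (cyc_map n (J - shift_residues n T))"
  have summand: "nc_scale (mn_p n M m a u) (act_word n (nc_h n i) u) =
      (\<Sum>p \<in> P. if u = ?word p then ?val p else 0)" for u
  proof -
    have "nc_scale (mn_p n M m a u) (act_word n (nc_h n i) u) =
        (\<Sum>J \<in> N i. \<Sum>T \<in> star_choices n a m J. if u = star_word (cyc_prev n J a) T
          then nc_basis (cyc_map n (J - shift_residues n T)) else 0)"
      unfolding h act_word_sum nc_scale_sum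
      using scaled_act_word_cyc_map [OF assms(1,2) _ assms(5)]
      by (intro sum.cong refl) (simp add: N_def)
    also have "\<dots> = (\<Sum>p \<in> P. if u = ?word p then ?val p else 0)"
      unfolding P_def using finN finite_star_choices by (subst sum.Sigma) (auto intro!: sum.cong)
    finally show ?thesis .
  qed
  have "D_op n (mn_p n M m a) (nc_h n i) = Sum_any (\<lambda>u. \<Sum>p \<in> P. if u = ?word p then ?val p else 0)"
    by (simp only: D_op_def summand)
  \<comment> \<open>Finitely many words contribute. Distinct pairs may give the same word, so the
    inner sum over pairs is kept until the order of summation is exchanged.\<close>
  also have "\<dots> = (\<Sum>u \<in> ?word ` P. \<Sum>p \<in> P. if u = ?word p then ?val p else 0)"
  proof (rule Sum_any.expand_superset)
    show "{u. (\<Sum>p \<in> P. if u = ?word p then ?val p else 0) \<noteq> 0} \<subseteq> ?word ` P"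
    proof
      fix u assume "u \<in> {u. (\<Sum>p \<in> P. if u = ?word p then ?val p else 0) \<noteq> 0}"
      then have "(\<Sum>p \<in> P. if u = ?word p then ?val p else 0) \<noteq> 0" by (rule CollectD)
      then obtain p where p: "p \<in> P" "(if u = ?word p then ?val p else 0) \<noteq> 0"
        by (rule sum.not_neutral_contains_not_neutral)
      from p(2) have "u = ?word p" by (rule contrapos_np) (rule if_not_P)
      with p(1) show "u \<in> ?word ` P" by (rule rev_image_eqI)
    qed
  qed (use finP in simp)
  also have "\<dots> = (\<Sum>p \<in> P. \<Sum>u \<in> ?word ` P. if u = ?word p then ?val p else 0)"
    by (rule sum.swap)
  also have "\<dots> = (\<Sum>p \<in> P. ?val p)"
    using finP by (intro sum.cong refl) (simp add: sum.delta)
  also have "\<dots> = (\<Sum>p \<in> P. nc_basis (cyc_map n ((\<lambda>(J, T). J - shift_residues n T) p)))"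
    by (intro sum.cong) auto
  \<comment> \<open>Each set of \<open>i - m\<close> residues arises from exactly one pair, so the
    sum can be reindexed.\<close>
  also have "\<dots> = nc_h n (i - m)"
    unfolding h using bij_betw_star_choices [OF assms(3,4), of a]
    by (intro sum.reindex_bij_betw) (simp add: P_def N_def)
  finally show ?thesis .
qed

end
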